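(* Let $F_A$ be the probabilistic cellular automaton on $\{0,1\}^{\mathbb Z}$ with neighborhood $V=(-1,0)$ and transition function $a$ given by $$a(00)(1)=\tfrac12,\quad a(01)(1)=0,\quad a(10)(1)=1,\quad a(11)(1)=\tfrac12$$ (and $a(w)(0)=1-a(w)(1)$). Then $F_A$ has a unique invariant measure, namely $$\mu=\tfrac12\left(\delta_{(01)^{\mathbb Z}}+\delta_{(10)^{\mathbb Z}}\right),$$ and $F_A$ is non-ergodic.
   Context: For a finite set $\Sigma$, $\mathcal M(\Sigma)$ is the set of probability measures on $\Sigma$; $X=\Sigma^{\mathbb Z}$ carries the product topology and $\mathcal M(X)$ is the set of Borel probability measures on $X$. For a finite $K\subset\mathbb Z$ and $x\in\Sigma^K$, the cylinder of $x$ is $*x*=\{u\in\Sigma^{\mathbb Z}:\ u_k=x_k\ \forall k\in K\}$. Given a neighborhood $V=(v_1,\dots,v_n)\in\mathbb Z^n$ and a transition function $f:\Sigma^V\to\mathcal M(\Sigma)$, the probabilistic cellular automaton (PCA) $F$ with transition function $f$ is the map $\mathcal M(X)\to\mathcal M(X)$, $\mu\mapsto\mu F$, determined on cylinders by: for every finite $K\subset\mathbb Z$ and $y\in\Sigma^K$, $$\mu F( *y* )=\sum_{x\in\Sigma^{V(K)}}\mu( *x* )\prod_{k\in K}f\big((x_i)_{i\in k+V}\big)(y_k),$$ where $k+V=(k+v_1,\dots,k+v_n)$ and $V(K)=\{k+v: k\in K, v\in V\}$. With $V=(-1,0)$, the new value of site $k$ is drawn according to $f(x_{k-1}x_k)$,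 independently over sites given the current configuration. An invariant measure of $F$ is $\mu\in\mathcal M(X)$ with $\mu F=\mu$. $F$ is ergodic if it has a unique invariant measure $\mu$ and, for every $\nu\in\mathcal M(X)$, $\nu F^n\to\mu$ weakly as $n\to\infty$. Non-ergodic means not ergodic. $(01)^{\mathbb Z}$ is the configuration $x$ with $x_{2n}=0$, $x_{2n+1}=1$ for all $n\in\mathbb Z$, and $(10)^{\mathbb Z}$ is the configuration with $x_{2n}=1$, $x_{2n+1}=0$ for all $n\in\mathbb Z$. $\delta_x$ is the Dirac measure at $x$. *)

theory Defs
  imports "HOL-Probability.Probability"
begin

section \<open>Configurations and measures\<close>

text \<open>
  The alphabet is a finite type with the discrete topology. The space \<open>int \<Rightarrow> 'a\<close> of
  configurations then carries the library's product topology on functions, and \<open>borel\<close> is its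
  Borel sigma-algebra.
\<close>

definition prob_measures :: "(int \<Rightarrow> 'a :: {finite, discrete_topology}) measure set" where
  "prob_measures = {\<mu>. prob_space \<mu> \<and> sets \<mu> = sets borel}"

text \<open>Only the values of the second argument on \<open>K\<close> matter.\<close>

definition cylinder :: "int set \<Rightarrow> (int \<Rightarrow> 'a) \<Rightarrow> (int \<Rightarrow> 'a) set" where
  "cylinder K x = {u. \<forall>k\<in>K. u k = x k}"

definition dirac :: "(int \<Rightarrow> 'a :: {finite, discrete_topology}) \<Rightarrow> (int \<Rightarrow> 'a) measure" where
  "dirac x = return borel x"

definition half_sum ::
  "(int \<Rightarrow> 'a :: {finite, discrete_topology}) measure \<Rightarrow> (int \<Rightarrow> 'a) measure \<Rightarrow> (int \<Rightarrow> 'a) measure"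
where
  "half_sum \<mu> \<nu> = measure_of UNIV (sets borel) (\<lambda>A. (emeasure \<mu> A + emeasure \<nu> A) / 2)"

definition weakly_converges ::
  "(nat \<Rightarrow> (int \<Rightarrow> 'a :: {finite, discrete_topology}) measure) \<Rightarrow> (int \<Rightarrow> 'a) measure \<Rightarrow> bool"
where
  "weakly_converges \<mu>s \<mu> \<longleftrightarrow>
     (\<forall>g :: (int \<Rightarrow> 'a) \<Rightarrow> real. continuous_on UNIV g \<longrightarrow> bounded (range g) \<longrightarrow>
        (\<lambda>n. integral\<^sup>L (\<mu>s n) g) \<longlonglongrightarrow> integral\<^sup>L \<mu> g)"


section \<open>Probabilistic cellular automata\<close>

text \<open>
  A neighborhood \<open>V = (v\<^sub>1, \<dots>, v\<^sub>n)\<close> is a list of integers. A transition function assigns to a word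
  a probability distribution on the alphabet; only words of length \<open>n\<close> are ever used.
\<close>

definition nbhd :: "int list \<Rightarrow> int set \<Rightarrow> int set" where
  "nbhd V K = {k + v | k v. k \<in> K \<and> v \<in> set V}"

definition local_word :: "int list \<Rightarrow> (int \<Rightarrow> 'a) \<Rightarrow> int \<Rightarrow> 'a list" where
  "local_word V x k = map (\<lambda>v. x (k + v)) V"

definition is_pca_image ::
  "int list \<Rightarrow> ('a :: {finite, discrete_topology} list \<Rightarrow> 'a pmf) \<Rightarrow>
   (int \<Rightarrow> 'a) measure \<Rightarrow> (int \<Rightarrow> 'a) measure \<Rightarrow> bool"
where
  "is_pca_image V f \<mu> \<nu> \<longleftrightarrow> \<nu> \<in> prob_measures \<and>
     (\<forall>K. finite K \<longrightarrow> (\<forall>y \<in> K \<rightarrow>\<^sub>E UNIV.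
        measure \<nu> (cylinder K y) =
          (\<Sum>x \<in> nbhd V K \<rightarrow>\<^sub>E UNIV. measure \<mu> (cylinder (nbhd V K) x) *
             (\<Prod>k\<in>K. pmf (f (local_word V x k)) (y k)))))"

text \<open>Existence and uniqueness of the image are shown in \<open>ex1_pca_image\<close> below.\<close>

definition pca ::
  "int list \<Rightarrow> ('a :: {finite, discrete_topology} list \<Rightarrow> 'a pmf) \<Rightarrow>
   (int \<Rightarrow> 'a) measure \<Rightarrow> (int \<Rightarrow> 'a) measure"
where
  "pca V f \<mu> = (THE \<nu>. is_pca_image V f \<mu> \<nu>)"

definition invariant_measure ::
  "((int \<Rightarrow> 'a :: {finite, discrete_topology}) measure \<Rightarrow> (int \<Rightarrow> 'a) measure) \<Rightarrow>
   (int \<Rightarrow> 'a) measure \<Rightarrow> bool"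
where
  "invariant_measure F \<mu> \<longleftrightarrow> \<mu> \<in> prob_measures \<and> F \<mu> = \<mu>"

definition ergodic ::
  "((int \<Rightarrow> 'a :: {finite, discrete_topology}) measure \<Rightarrow> (int \<Rightarrow> 'a) measure) \<Rightarrow> bool"
where
  "ergodic F \<longleftrightarrow>
     (\<exists>\<mu>. invariant_measure F \<mu> \<and> (\<forall>\<nu>. invariant_measure F \<nu> \<longrightarrow> \<nu> = \<mu>) \<and>
          (\<forall>\<nu>\<in>prob_measures. weakly_converges (\<lambda>n. (F ^^ n) \<nu>) \<mu>))"


section \<open>The two alternating configurations\<close>

text \<open>The symbols 0 and 1 are \<open>False\<close> and \<open>True\<close>.\<close>

definition config01 :: "int \<Rightarrow> bool" where
  "config01 i \<longleftrightarrow> odd i"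

definition config10 :: "int \<Rightarrow> bool" where
  "config10 i \<longleftrightarrow> even i"


section \<open>Well-definedness\<close>

lemma emeasure_half_sum:
  assumes "sets \<mu> = sets borel" "sets \<nu> = sets borel" "A \<in> sets borel"
  shows "emeasure (half_sum \<mu> \<nu>) A = (emeasure \<mu> A + emeasure \<nu> A) / 2"
proof (rule emeasure_measure_of[OF half_sum_def])
  show "countably_additive (sets (half_sum \<mu> \<nu>)) (\<lambda>A. (emeasure \<mu> A + emeasure \<nu> A) / 2)"
  proof (rule countably_additiveI)
    have s: "sets (half_sum \<mu> \<nu>) = sets borel"
      unfolding half_sum_def by (metis sets.sigma_sets_eq sets_measure_of space_borel sets.space_closed)
    fix B :: "nat \<Rightarrow> (int \<Rightarrow> 'a) set"
    assume "range B \<subseteq> sets (half_sum \<mu> \<nu>)" "disjoint_family B"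
    then show "(\<Sum>i. (emeasure \<mu> (B i) + emeasure \<nu> (B i)) / 2) =
        (emeasure \<mu> (\<Union> (range B)) + emeasure \<nu> (\<Union> (range B))) / 2"
      using assms s by (simp add: ennreal_suminf_divide suminf_add[symmetric] suminf_emeasure)
  qed
  show "A \<in> sets (half_sum \<mu> \<nu>)"
    unfolding half_sum_def using assms(3)
    by (metis sets.sigma_sets_eq sets_measure_of space_borel sets.space_closed)
qed (auto simp: positive_def)

definition cylinders :: "(int \<Rightarrow> 'a) set set" where
  "cylinders = insert {} {cylinder K y | K y. finite K}"

lemma cylinder_in_cylinders: "finite K \<Longrightarrow> cylinder K y \<in> cylinders"
  unfolding cylinders_def by blast

lemma cylinder_restrict: "cylinder K (restrict y K) = cylinder K y"
  unfolding cylinder_def by auto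

lemma Int_stable_cylinders: "Int_stable (cylinders :: (int \<Rightarrow> 'a) set set)"
proof (rule Int_stableI)
  fix A B :: "(int \<Rightarrow> 'a) set" assume "A \<in> cylinders" "B \<in> cylinders"
  then consider "A \<inter> B = {}"
    | K y L z where "finite K" "A = cylinder K y" "finite L" "B = cylinder L z" "A \<inter> B \<noteq> {}"
    unfolding cylinders_def by blast
  then show "A \<inter> B \<in> cylinders"
  proof cases
    case 2
    then obtain w where "w \<in> A" "w \<in> B" by blast
    then have "A \<inter> B = cylinder (K \<union> L) w"
      using 2 unfolding cylinder_def by auto
    then show ?thesis using 2 by (simp add: cylinder_in_cylinders)
  qed (simp add: cylinders_def)
qed

lemma countable_cylinders: "countable (cylinders :: (int \<Rightarrow> 'a :: finite) set set)"
proof -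
  have "cylinders \<subseteq> insert {}
      ((\<lambda>(K, y). cylinder K y) ` (SIGMA K:{K. finite K}. K \<rightarrow>\<^sub>E (UNIV :: 'a set)))"
  proof
    fix A :: "(int \<Rightarrow> 'a) set" assume "A \<in> cylinders"
    then consider "A = {}" | K y where "finite K" "A = cylinder K y"
      unfolding cylinders_def by blast
    then show "A \<in> insert {} ((\<lambda>(K, y). cylinder K y) ` (SIGMA K:{K. finite K}. K \<rightarrow>\<^sub>E UNIV))"
    proof cases
      case 2
      then have "A = (\<lambda>(K, y). cylinder K y) (K, restrict y K)"
        by (simp add: cylinder_restrict)
      with 2 show ?thesis by (intro insertI2 image_eqI[of _ _ "(K, restrict y K)"]) simp_all
    qed simp
  qed
  moreover have "countable (SIGMA K:{K :: int set. finite K}. K \<rightarrow>\<^sub>E (UNIV :: 'a set))"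
    by (intro countable_SIGMA countable_Collect_finite) (auto intro!: countable_finite finite_PiE)
  ultimately show ?thesis
    by (meson countable_subset countable_insert countable_image)
qed

lemma open_cylinder:
  fixes y :: "int \<Rightarrow> 'a :: {finite, discrete_topology}"
  assumes "finite K"
  shows "open (cylinder K y)"
proof -
  have "cylinder K y = (\<Inter>k\<in>K. (\<lambda>u. u k) -` {y k})"
    unfolding cylinder_def by auto
  moreover have "open ((\<lambda>u :: int \<Rightarrow> 'a. u k) -` {y k})" for k
    by (intro open_vimage discrete_topology_class.open_discrete continuous_on_product_coordinates)
  ultimately show ?thesis using assms by (simp add: open_INT)
qed

lemma sets_borel_cylinders:
  "sets (borel :: (int \<Rightarrow> 'a :: {finite, discrete_topology}) measure) = sigma_sets UNIV cylinders"
proof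
  have "A \<in> sigma_sets UNIV cylinders" if opA: "open A" for A :: "(int \<Rightarrow> 'a) set"
  proof -
    have "A = \<Union> {C \<in> cylinders. C \<subseteq> A}"
    proof (intro equalityI subsetI)
      fix u assume "u \<in> A"
      then obtain X where X: "u \<in> (\<Pi>\<^sub>E i\<in>UNIV. X i)" "finite {i. X i \<noteq> UNIV}" "(\<Pi>\<^sub>E i\<in>UNIV. X i) \<subseteq> A"
        using product_topology_open_contains_basis[OF opA[unfolded open_fun_def], of u] by simp blast
      define K where "K = {i. X i \<noteq> UNIV}"
      have "cylinder K u \<subseteq> A"
        using X unfolding cylinder_def K_def
        by (intro order_trans[OF _ X(3)]) (fastforce simp: PiE_iff)
      moreover have "u \<in> cylinder K u" "cylinder K u \<in> cylinders"
        using X(2) cylinder_in_cylinders[of K u] by (simp_all add: cylinder_def K_def)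
      ultimately show "u \<in> \<Union> {C \<in> cylinders. C \<subseteq> A}" by blast
    qed auto
    moreover have "\<Union> {C \<in> cylinders. C \<subseteq> A} \<in> sigma_sets UNIV cylinders"
      by (rule sigma_sets_UNION)
         (auto intro: countable_subset[OF _ countable_cylinders] sigma_sets.Basic)
    ultimately show ?thesis by simp
  qed
  then have "sigma_sets UNIV {S :: (int \<Rightarrow> 'a) set. open S} \<subseteq> sigma_sets UNIV cylinders"
    by (intro sigma_sets_mono) auto
  then show "sets (borel :: (int \<Rightarrow> 'a) measure) \<subseteq> sigma_sets UNIV cylinders"
    by (simp add: sets_borel)
  have "(cylinders :: (int \<Rightarrow> 'a) set set) \<subseteq> sets borel"
    unfolding cylinders_def by (auto intro!: borel_open open_cylinder)
  then show "sigma_sets UNIV cylinders \<subseteq> sets (borel :: (int \<Rightarrow> 'a) measure)"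
    using sets.sigma_sets_subset[of cylinders "borel :: (int \<Rightarrow> 'a) measure"] by simp
qed

lemma borel_cylinder [measurable]:
  "finite K \<Longrightarrow> cylinder K y \<in> sets (borel :: (int \<Rightarrow> 'a :: {finite, discrete_topology}) measure)"
  by (intro borel_open open_cylinder)

lemma measure_eqI_cylinder:
  fixes \<mu> \<nu> :: "(int \<Rightarrow> 'a :: {finite, discrete_topology}) measure"
  assumes "\<mu> \<in> prob_measures" "\<nu> \<in> prob_measures"
    and eq: "\<And>K y. finite K \<Longrightarrow> y \<in> K \<rightarrow>\<^sub>E UNIV \<Longrightarrow> measure \<mu> (cylinder K y) = measure \<nu> (cylinder K y)"
  shows "\<mu> = \<nu>"
proof -
  interpret \<mu>: prob_space \<mu> using assms by (simp add: prob_measures_def)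
  interpret \<nu>: prob_space \<nu> using assms by (simp add: prob_measures_def)
  show ?thesis
  proof (rule measure_eqI_generator_eq[OF Int_stable_cylinders, where A = "\<lambda>_. UNIV" and \<Omega> = UNIV])
    show "sets \<mu> = sigma_sets UNIV cylinders" "sets \<nu> = sigma_sets UNIV cylinders"
      using assms by (simp_all add: prob_measures_def sets_borel_cylinders)
    show "range (\<lambda>_ :: nat. UNIV) \<subseteq> (cylinders :: (int \<Rightarrow> 'a) set set)"
      using cylinder_in_cylinders[of "{}"] by (auto simp: cylinder_def)
    show "emeasure \<mu> X = emeasure \<nu> X" if "X \<in> cylinders" for X
    proof -
      from that consider "X = {}" | K y where "finite K" "X = cylinder K y"
        unfolding cylinders_def by blast
      then show ?thesis
      proof cases
        case 2
        with eq[of K "restrict y K"] show ?thesis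
          by (simp add: cylinder_restrict \<mu>.emeasure_eq_measure \<nu>.emeasure_eq_measure)
      qed simp
    qed
  qed (simp_all add: \<mu>.emeasure_eq_measure)
qed

lemma finite_nbhd: "finite K \<Longrightarrow> finite (nbhd V K)"
proof -
  assume "finite K"
  moreover have "nbhd V K = (\<lambda>(k, v). k + v) ` (K \<times> set V)"
    unfolding nbhd_def by auto
  ultimately show ?thesis by simp
qed

lemma sets_PiM_eq_borel:
  "sets (PiM UNIV (\<lambda>k. measure_pmf (p k))) =
   sets (borel :: (int \<Rightarrow> 'a :: {finite, discrete_topology}) measure)" (is "sets ?M = _")
proof
  have 1: "sets ?M = sigma_sets UNIV {{f. f i \<in> A} | i A. True}"
    by (subst sets_PiM_single) simp
  have "open {f :: int \<Rightarrow> 'a. f i \<in> A}" for i A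
    using open_vimage[OF discrete_topology_class.open_discrete[of A] continuous_on_product_coordinates[of i]]
    by (simp add: vimage_def)
  then have "{{f. f i \<in> A} | i A. True} \<subseteq> sets (borel :: (int \<Rightarrow> 'a) measure)" by auto
  then show "sets ?M \<subseteq> sets borel"
    unfolding 1
    using sets.sigma_sets_subset[of _ "borel :: (int \<Rightarrow> 'a) measure"] by simp
  have "cylinder K y \<in> sets ?M" if "finite K" for K y
  proof -
    have "cylinder K y = prod_emb UNIV (\<lambda>k. measure_pmf (p k)) K (\<Pi>\<^sub>E k\<in>K. {y k})"
      by (auto simp: cylinder_def prod_emb_def PiE_iff)
    with that show ?thesis by (auto intro!: sets_PiM_I)
  qed
  then have "cylinders \<subseteq> sets ?M" by (auto simp: cylinders_def)
  then show "sets borel \<subseteq> sets ?M"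
    unfolding sets_borel_cylinders
    using sets.sigma_sets_subset[of _ ?M] by (simp add: space_PiM)
qed

lemma ex1_pca_image:
  fixes f :: "'a :: {finite, discrete_topology} list \<Rightarrow> 'a pmf"
  assumes \<mu>: "\<mu> \<in> prob_measures"
  shows "\<exists>!\<nu>. is_pca_image V f \<mu> \<nu>"
proof (rule ex_ex1I)
  interpret \<mu>: prob_space \<mu> using \<mu> by (simp add: prob_measures_def)
  have s: "sets \<mu> = sets borel" using \<mu> by (simp add: prob_measures_def)
  define \<kappa> where "\<kappa> x = PiM UNIV (\<lambda>k. measure_pmf (f (local_word V x k)))" for x
  have prob: "prob_space (\<kappa> x)" for x
    unfolding \<kappa>_def by (intro prob_space_PiM measure_pmf.prob_space_axioms)
  have sets_\<kappa>: "sets (\<kappa> x) = sets borel" for x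
    unfolding \<kappa>_def by (rule sets_PiM_eq_borel)
  have cyl: "emeasure (\<kappa> x) (cylinder K y) = (\<Prod>k\<in>K. pmf (f (local_word V x k)) (y k))"
    if "finite K" for x K y
  proof -
    have "cylinder K y = prod_emb UNIV (\<lambda>k. measure_pmf (f (local_word V x k))) K (\<Pi>\<^sub>E k\<in>K. {y k})"
      by (auto simp: cylinder_def prod_emb_def PiE_iff)
    then have "emeasure (\<kappa> x) (cylinder K y) =
        (\<Prod>k\<in>K. emeasure (measure_pmf (f (local_word V x k))) {y k})"
      using that unfolding \<kappa>_def
      by (simp del: emeasure_pmf_single add: emeasure_PiM_emb measure_pmf.prob_space_axioms)
    then show ?thesis by (simp add: emeasure_pmf_single prod_ennreal)
  qed
  have decomp: "emeasure (\<kappa> x) (cylinder K y) =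
      (\<Sum>z \<in> nbhd V K \<rightarrow>\<^sub>E UNIV. ennreal (\<Prod>k\<in>K. pmf (f (local_word V z k)) (y k)) *
         indicator (cylinder (nbhd V K) z) x)" (is "_ = (\<Sum>z\<in>?Z. ?g z)")
    if "finite K" for x K y
  proof -
    have fin: "finite ?Z" using that by (auto intro!: finite_PiE finite_nbhd)
    define x' where "x' = restrict x (nbhd V K)"
    have "?g z = 0" if "z \<in> ?Z - {x'}" for z
    proof -
      have "z = x'" if "x \<in> cylinder (nbhd V K) z"
        using that \<open>z \<in> ?Z - {x'}\<close> by (auto simp: cylinder_def x'_def PiE_iff extensional_def)
      with that show ?thesis by (auto simp: indicator_def)
    qed
    moreover have "x' \<in> ?Z" by (simp add: x'_def)
    ultimately have "(\<Sum>z\<in>?Z. ?g z) = sum ?g {x'}"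
      by (intro sum.mono_neutral_right[OF fin]) blast+
    moreover have "x \<in> cylinder (nbhd V K) x'" by (simp add: cylinder_def x'_def)
    moreover have "local_word V x' k = local_word V x k" if "k \<in> K" for k
      using that by (auto simp: local_word_def x'_def nbhd_def)
    ultimately show ?thesis using cyl[OF that] by simp
  qed
  have meas: "\<kappa> \<in> measurable \<mu> (prob_algebra borel)"
  proof (rule measurable_prob_algebra_generated[OF sets_borel_cylinders Int_stable_cylinders])
    fix A :: "(int \<Rightarrow> 'a) set" assume "A \<in> cylinders"
    then consider "A = {}" | K y where "finite K" "A = cylinder K y"
      unfolding cylinders_def by blast
    then show "(\<lambda>x. emeasure (\<kappa> x) A) \<in> borel_measurable \<mu>"
    proof cases
      case 2
      have "cylinder (nbhd V K) z \<in> sets \<mu>" for z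
        unfolding s using 2 by (intro borel_cylinder finite_nbhd)
      then show ?thesis using 2 by (simp add: decomp)
    qed simp
  qed (simp_all add: prob sets_\<kappa>)
  have ne: "space \<mu> \<noteq> {}" by (rule \<mu>.not_empty)
  define \<nu> where "\<nu> = \<mu> \<bind> \<kappa>"
  have \<mu>a: "\<mu> \<in> space (prob_algebra \<mu>)"
    by (simp add: space_prob_algebra \<mu>.prob_space_axioms)
  have sub: "\<kappa> \<in> measurable \<mu> (subprob_algebra borel)"
    by (rule measurable_prob_algebraD[OF meas])
  have \<nu>: "\<nu> \<in> prob_measures"
    unfolding \<nu>_def prob_measures_def
    using prob_space_bind'[OF \<mu>a meas] sets_bind'[OF \<mu>a meas] by simp
  then interpret \<nu>: prob_space \<nu> by (simp add: prob_measures_def)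
  have "is_pca_image V f \<mu> \<nu>"
    unfolding is_pca_image_def
  proof (intro conjI allI impI ballI \<nu>)
    fix K :: "int set" and y :: "int \<Rightarrow> 'a" assume K: "finite K"
    let ?c = "\<lambda>z. \<Prod>k\<in>K. pmf (f (local_word V z k)) (y k)"
    have c: "cylinder (nbhd V K) z \<in> sets \<mu>" for z
      unfolding s using K by (intro borel_cylinder finite_nbhd)
    have "emeasure \<nu> (cylinder K y) = (\<integral>\<^sup>+x. emeasure (\<kappa> x) (cylinder K y) \<partial>\<mu>)"
      unfolding \<nu>_def by (rule emeasure_bind[OF ne sub borel_cylinder[OF K]])
    also have "\<dots> = (\<Sum>z \<in> nbhd V K \<rightarrow>\<^sub>E UNIV. ennreal (?c z) * emeasure \<mu> (cylinder (nbhd V K) z))"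
      using c K by (simp add: decomp nn_integral_sum nn_integral_cmult)
    also have "\<dots> = ennreal (\<Sum>z \<in> nbhd V K \<rightarrow>\<^sub>E UNIV. measure \<mu> (cylinder (nbhd V K) z) * ?c z)"
    proof -
      have "ennreal (?c z) * emeasure \<mu> (cylinder (nbhd V K) z) =
          ennreal (measure \<mu> (cylinder (nbhd V K) z) * ?c z)" for z
        unfolding \<mu>.emeasure_eq_measure
        by (subst ennreal_mult) (simp_all add: prod_nonneg mult.commute)
      then show ?thesis
        by (simp only:) (rule sum_ennreal, simp add: prod_nonneg)
    qed
    finally show "measure \<nu> (cylinder K y) =
        (\<Sum>z \<in> nbhd V K \<rightarrow>\<^sub>E UNIV. measure \<mu> (cylinder (nbhd V K) z) * ?c z)"
      by (simp add: \<nu>.emeasure_eq_measure sum_nonneg prod_nonneg)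
  qed
  then show "\<exists>\<nu>. is_pca_image V f \<mu> \<nu>" ..
next
  fix \<nu> \<nu>' assume im: "is_pca_image V f \<mu> \<nu>" "is_pca_image V f \<mu> \<nu>'"
  show "\<nu> = \<nu>'"
  proof (rule measure_eqI_cylinder)
    show "\<nu> \<in> prob_measures" "\<nu>' \<in> prob_measures"
      using im by (simp_all add: is_pca_image_def)
    show "measure \<nu> (cylinder K y) = measure \<nu>' (cylinder K y)"
      if "finite K" "y \<in> K \<rightarrow>\<^sub>E UNIV" for K y
      using im[unfolded is_pca_image_def, THEN conjunct2, rule_format, OF that] by (simp only:)
  qed
qed

end

theory Submission
  imports Defs
begin

text \<open>
  In the spins \<open>s\<^sub>k = \<plusminus>1\<close> the conditional mean of the new value at \<open>k\<close> is \<open>(s\<^sub>k\<^sub>-\<^sub>1 - s\<^sub>k) / 2\<close>. Hence, up to a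
  sign alternating in space and time, \<open>F\<^sub>A\<close> is a voter model whose sites copy themselves or their
  left neighbor with probability one half. For an invariant measure, the probability \<open>d i j / 2\<close> that
  \<open>i\<close> and \<open>j\<close> disagree after removing this sign is off the diagonal the average of its
  values at \<open>(i-1, j-1)\<close>, \<open>(i-1, j)\<close>, \<open>(i, j-1)\<close>, \<open>(i, j)\<close>, and it vanishes on the diagonal.
  Its supremum over pairs at distance \<open>m\<close> is therefore a bounded convex sequence in \<open>m\<close> starting
  at \<open>0\<close>, so it is zero. The measure thus lives on the two alternating configurations; since
  \<open>F\<^sub>A\<close> swaps them, both have mass one half, and the orbit of \<open>\<delta>\<close> at one of them does not converge.
\<close>

section \<open>Integrals of local functions and one step of an automaton\<close>

lemma prob_measuresD:
  assumes "\<mu> \<in> prob_measures"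
  shows "prob_space \<mu>" "sets \<mu> = sets borel" "space \<mu> = UNIV"
  using assms sets_eq_imp_space_eq[of \<mu> borel] by (auto simp: prob_measures_def)

text \<open>The hypothesis on \<open>g\<close> says that it depends only on the coordinates in
  \<open>N\<close>. Each \<open>x\<close> lies in exactly one cylinder over \<open>N\<close>, the
  one indexed by \<open>restrict x N\<close>, so \<open>g\<close> is a finite linear combination of
  indicators.\<close>

lemma
  fixes g :: "(int \<Rightarrow> 'a :: {finite, discrete_topology}) \<Rightarrow> real"
  assumes \<mu>: "\<mu> \<in> prob_measures" and "finite N" and g: "\<And>x. g (restrict x N) = g x"
  shows integrable_finite_dep: "integrable \<mu> g"
    and integral_finite_dep:
      "integral\<^sup>L \<mu> g = (\<Sum>z\<in>N \<rightarrow>\<^sub>E UNIV. measure \<mu> (cylinder N z) * g z)"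
proof -
  interpret prob_space \<mu> by (rule prob_measuresD[OF \<mu>])
  have s: "cylinder N z \<in> sets \<mu>" for z :: "int \<Rightarrow> 'a"
    using prob_measuresD(2)[OF \<mu>] \<open>finite N\<close> by simp
  have eq: "g = (\<lambda>x. \<Sum>z\<in>N \<rightarrow>\<^sub>E UNIV. indicator (cylinder N z) x * g z)"
  proof
    fix x
    have "indicator (cylinder N z) x = (if z = restrict x N then 1 else 0 :: real)"
      if "z \<in> N \<rightarrow>\<^sub>E UNIV" for z :: "int \<Rightarrow> 'a"
    proof -
      have "x \<in> cylinder N z \<longleftrightarrow> z = restrict x N"
        using that by (auto simp: cylinder_def PiE_iff extensional_def)
      then show ?thesis by (simp add: indicator_def)
    qed
    then have "(\<Sum>z\<in>N \<rightarrow>\<^sub>E UNIV. indicator (cylinder N z) x * g z) =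
        (\<Sum>z\<in>N \<rightarrow>\<^sub>E UNIV. if z = restrict x N then g z else 0)"
      by (intro sum.cong) auto
    also have "\<dots> = g (restrict x N)"
      using \<open>finite N\<close> by (simp add: finite_PiE)
    finally show "g x = (\<Sum>z\<in>N \<rightarrow>\<^sub>E UNIV. indicator (cylinder N z) x * g z)"
      using g by simp
  qed
  have i: "integrable \<mu> (\<lambda>x. indicator (cylinder N z) x * g z)" for z
    using s by (intro integrable_mult_left) (simp add: emeasure_eq_measure)
  show "integrable \<mu> g" by (subst eq) (intro Bochner_Integration.integrable_sum i)
  have "integral\<^sup>L \<mu> g = (\<Sum>z\<in>N \<rightarrow>\<^sub>E UNIV. \<integral>x. indicator (cylinder N z) x * g z \<partial>\<mu>)"
    by (subst eq) (intro Bochner_Integration.integral_sum i)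
  also have "\<dots> = (\<Sum>z\<in>N \<rightarrow>\<^sub>E UNIV. measure \<mu> (cylinder N z) * g z)"
    using s prob_measuresD(3)[OF \<mu>] by simp
  finally show "integral\<^sup>L \<mu> g = (\<Sum>z\<in>N \<rightarrow>\<^sub>E UNIV. measure \<mu> (cylinder N z) * g z)" .
qed

lemma local_word_restrict:
  "k \<in> K \<Longrightarrow> local_word V (restrict x (nbhd V K)) k = local_word V x k"
  by (auto simp: local_word_def nbhd_def)

lemma pca_eqI:
  assumes "\<mu> \<in> prob_measures" "is_pca_image V f \<mu> \<nu>"
  shows "pca V f \<mu> = \<nu>"
  unfolding pca_def using ex1_pca_image[OF assms(1)] assms(2) by (rule the1_equality)

lemma is_pca_image_pca: "\<mu> \<in> prob_measures \<Longrightarrow> is_pca_image V f \<mu> (pca V f \<mu>)"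
  unfolding pca_def by (rule theI'[OF ex1_pca_image])

text \<open>Given the old configuration, the new values are independent, so the conditional mean of
  a product over distinct sites is the product of the one-site means. On cylinders this is the
  distributive law \<open>prod_sum_PiE\<close>.\<close>

lemma integral_prod_is_pca_image:
  fixes g :: "int \<Rightarrow> 'a :: {finite, discrete_topology} \<Rightarrow> real"
  assumes \<mu>: "\<mu> \<in> prob_measures" and im: "is_pca_image V f \<mu> \<nu>" and K: "finite K"
  shows "(\<integral>x. (\<Prod>k\<in>K. g k (x k)) \<partial>\<nu>) =
    (\<integral>x. (\<Prod>k\<in>K. \<Sum>b\<in>UNIV. g k b * pmf (f (local_word V x k)) b) \<partial>\<mu>)"
proof -
  let ?N = "nbhd V K"
  let ?p = "\<lambda>x k b. pmf (f (local_word V x k)) b"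
  have \<nu>: "\<nu> \<in> prob_measures" using im by (simp add: is_pca_image_def)
  have "(\<integral>x. (\<Prod>k\<in>K. g k (x k)) \<partial>\<nu>) =
      (\<Sum>y\<in>K \<rightarrow>\<^sub>E UNIV. measure \<nu> (cylinder K y) * (\<Prod>k\<in>K. g k (y k)))"
    by (rule integral_finite_dep[OF \<nu> K]) (simp cong: prod.cong)
  also have "\<dots> = (\<Sum>y\<in>K \<rightarrow>\<^sub>E UNIV. \<Sum>z\<in>?N \<rightarrow>\<^sub>E UNIV.
      measure \<mu> (cylinder ?N z) * (\<Prod>k\<in>K. g k (y k) * ?p z k (y k)))"
  proof (rule sum.cong[OF refl])
    fix y :: "int \<Rightarrow> 'a" assume "y \<in> K \<rightarrow>\<^sub>E UNIV"
    then have "measure \<nu> (cylinder K y) =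
        (\<Sum>z\<in>?N \<rightarrow>\<^sub>E UNIV. measure \<mu> (cylinder ?N z) * (\<Prod>k\<in>K. ?p z k (y k)))"
      using im K unfolding is_pca_image_def by blast
    then show "measure \<nu> (cylinder K y) * (\<Prod>k\<in>K. g k (y k)) =
        (\<Sum>z\<in>?N \<rightarrow>\<^sub>E UNIV. measure \<mu> (cylinder ?N z) * (\<Prod>k\<in>K. g k (y k) * ?p z k (y k)))"
      by (simp add: sum_distrib_left sum_distrib_right prod.distrib mult_ac)
  qed
  also have "\<dots> = (\<Sum>z\<in>?N \<rightarrow>\<^sub>E UNIV. measure \<mu> (cylinder ?N z) *
      (\<Sum>y\<in>K \<rightarrow>\<^sub>E UNIV. \<Prod>k\<in>K. g k (y k) * ?p z k (y k)))"
    by (subst sum.swap) (simp add: sum_distrib_left)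
  also have "\<dots> = (\<Sum>z\<in>?N \<rightarrow>\<^sub>E UNIV. measure \<mu> (cylinder ?N z) *
      (\<Prod>k\<in>K. \<Sum>b\<in>UNIV. g k b * ?p z k b))"
    using K by (simp add: prod_sum_PiE)
  also have "\<dots> = (\<integral>x. (\<Prod>k\<in>K. \<Sum>b\<in>UNIV. g k b * ?p x k b) \<partial>\<mu>)"
    by (rule integral_finite_dep[OF \<mu> finite_nbhd[OF K], symmetric])
       (simp add: local_word_restrict cong: prod.cong)
  finally show ?thesis .
qed

section \<open>Dirac measures and half sums\<close>

lemma dirac_in_prob_measures: "dirac x \<in> prob_measures"
  by (simp add: dirac_def prob_measures_def prob_space_return)

lemma is_pca_image_dirac:
  fixes f :: "'a :: {finite, discrete_topology} list \<Rightarrow> 'a pmf"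
  assumes "\<And>k. pmf (f (local_word V x k)) (y k) = 1"
  shows "is_pca_image V f (dirac x) (dirac y)"
  unfolding is_pca_image_def
proof (intro conjI allI impI ballI dirac_in_prob_measures)
  fix K :: "int set" and w :: "int \<Rightarrow> 'a"
  assume K: "finite K"
  let ?g = "\<lambda>x. \<Prod>k\<in>K. pmf (f (local_word V x k)) (w k)"
  have "f (local_word V x k) = return_pmf (y k)" for k
  proof -
    have "measure_pmf.prob (f (local_word V x k)) {y k} = 1"
      using assms by (simp add: measure_pmf_single)
    then have "AE b in measure_pmf (f (local_word V x k)). b \<in> {y k}"
      by (subst (asm) measure_pmf.prob_eq_1) auto
    then have "set_pmf (f (local_word V x k)) \<subseteq> {y k}" by (auto simp: AE_measure_pmf_iff)
    then show ?thesis by (simp add: set_pmf_subset_singleton)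
  qed
  then have "?g x = indicator (cylinder K w) y"
    using K by (auto simp: cylinder_def indicator_def)
  then have "measure (dirac y) (cylinder K w) = ?g x"
    using K by (simp add: dirac_def measure_return)
  also have "\<dots> = (\<integral>x. ?g x \<partial>dirac x)"
  proof -
    \<comment> \<open>Integrability serves to provide the Borel measurability of \<open>?g\<close>,
      which is what evaluating the integral against a point mass requires.\<close>
    have "integrable (dirac x) ?g"
      by (rule integrable_finite_dep[OF dirac_in_prob_measures finite_nbhd[OF K, of V]])
         (simp add: local_word_restrict cong: prod.cong)
    then have "?g \<in> borel_measurable borel"
      using borel_measurable_integrable by (fastforce simp: dirac_def)
    then show ?thesis by (simp add: dirac_def integral_return)
  qed
  also have "\<dots> = (\<Sum>z\<in>nbhd V K \<rightarrow>\<^sub>E UNIV. measure (dirac x) (cylinder (nbhd V K) z) * ?g z)"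
    by (rule integral_finite_dep[OF dirac_in_prob_measures finite_nbhd[OF K]])
       (simp add: local_word_restrict cong: prod.cong)
  finally show "measure (dirac y) (cylinder K w) =
    (\<Sum>z\<in>nbhd V K \<rightarrow>\<^sub>E UNIV. measure (dirac x) (cylinder (nbhd V K) z) * ?g z)" .
qed

lemma half_sum_in_prob_measures:
  assumes "\<mu> \<in> prob_measures" "\<nu> \<in> prob_measures"
  shows "half_sum \<mu> \<nu> \<in> prob_measures"
proof -
  interpret \<mu>: prob_space \<mu> by (rule prob_measuresD[OF assms(1)])
  interpret \<nu>: prob_space \<nu> by (rule prob_measuresD[OF assms(2)])
  have s: "sets (half_sum \<mu> \<nu>) = sets borel" "space (half_sum \<mu> \<nu>) = UNIV"
    unfolding half_sum_def
    by (metis sets.sigma_sets_eq sets_measure_of space_borel sets.space_closed)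
       (simp add: space_measure_of_conv)
  moreover have "prob_space (half_sum \<mu> \<nu>)"
  proof (rule prob_spaceI)
    have "emeasure (half_sum \<mu> \<nu>) UNIV = (emeasure \<mu> UNIV + emeasure \<nu> UNIV) / 2"
      using assms[THEN prob_measuresD(2)] by (rule emeasure_half_sum) simp
    then show "emeasure (half_sum \<mu> \<nu>) (space (half_sum \<mu> \<nu>)) = 1"
      using \<mu>.emeasure_space_1 \<nu>.emeasure_space_1 assms[THEN prob_measuresD(3)]
      by (simp add: s)
  qed
  ultimately show ?thesis by (simp add: prob_measures_def)
qed

lemma measure_half_sum:
  assumes "\<mu> \<in> prob_measures" "\<nu> \<in> prob_measures" "A \<in> sets borel"
  shows "measure (half_sum \<mu> \<nu>) A = (measure \<mu> A + measure \<nu> A) / 2"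
proof -
  interpret \<mu>: prob_space \<mu> by (rule prob_measuresD[OF assms(1)])
  interpret \<nu>: prob_space \<nu> by (rule prob_measuresD[OF assms(2)])
  interpret h: prob_space "half_sum \<mu> \<nu>"
    by (rule prob_measuresD[OF half_sum_in_prob_measures[OF assms(1,2)]])
  have "ennreal (measure (half_sum \<mu> \<nu>) A) = ennreal (measure \<mu> A + measure \<nu> A) / ennreal 2"
    using emeasure_half_sum[OF assms(1,2)[THEN prob_measuresD(2)] assms(3)]
    unfolding \<mu>.emeasure_eq_measure \<nu>.emeasure_eq_measure h.emeasure_eq_measure by simp
  also have "\<dots> = ennreal ((measure \<mu> A + measure \<nu> A) / 2)"
    by (rule divide_ennreal) auto
  finally show ?thesis by simp
qed

text \<open>Both sides of the cylinder equations are linear in the measures, so two instances can be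
  averaged.\<close>

lemma is_pca_image_half_sum:
  assumes \<mu>: "\<mu> \<in> prob_measures" "\<mu>' \<in> prob_measures"
    and im: "is_pca_image V f \<mu> \<nu>" "is_pca_image V f \<mu>' \<nu>'"
  shows "is_pca_image V f (half_sum \<mu> \<mu>') (half_sum \<nu> \<nu>')"
proof -
  have \<nu>: "\<nu> \<in> prob_measures" "\<nu>' \<in> prob_measures" using im by (simp_all add: is_pca_image_def)
  show ?thesis
    unfolding is_pca_image_def
  proof (intro conjI half_sum_in_prob_measures \<nu> allI impI ballI)
    fix K :: "int set" and y :: "int \<Rightarrow> 'a"
    assume K: "finite K" "y \<in> K \<rightarrow>\<^sub>E UNIV"
    note * = im[unfolded is_pca_image_def, THEN conjunct2, rule_format, OF K]
    show "measure (half_sum \<nu> \<nu>') (cylinder K y) =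
      (\<Sum>z\<in>nbhd V K \<rightarrow>\<^sub>E UNIV. measure (half_sum \<mu> \<mu>') (cylinder (nbhd V K) z) *
        (\<Prod>k\<in>K. pmf (f (local_word V z k)) (y k)))"
      using K(1) finite_nbhd[OF K(1)]
      by (simp add: measure_half_sum \<mu> \<nu> * sum.distrib[symmetric] sum_divide_distrib
          distrib_right[symmetric])
  qed
qed

lemma half_sum_commute: "half_sum \<mu> \<nu> = half_sum \<nu> \<mu>"
  by (simp add: half_sum_def add.commute)

section \<open>Convex sequences and bounded harmonic functions\<close>

lemma convex_bounded_seq_le:
  fixes e :: "nat \<Rightarrow> real"
  assumes conv: "\<And>m. 2 * e (Suc m) \<le> e m + e (Suc (Suc m))" and bd: "\<And>m. e m \<le> B"
  shows "e m \<le> e 0"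
proof -
  have "e (Suc m) \<le> e m" for m
  proof (rule ccontr)
    assume "\<not> e (Suc m) \<le> e m"
    then have pos: "e (Suc m) - e m > 0" by simp
    \<comment> \<open>By convexity the increments never decrease, so a single positive one forces
      linear growth, which eventually exceeds \<open>B\<close>.\<close>
    have inc: "e (Suc (m + n)) - e (m + n) \<ge> e (Suc m) - e m" for n
    proof (induction n)
      case (Suc n)
      then show ?case using conv[of "m + n"] by simp
    qed simp
    have "e (m + n) \<ge> e m + real n * (e (Suc m) - e m)" for n
    proof (induction n)
      case (Suc n)
      then show ?case using inc[of n] by (simp add: algebra_simps)
    qed simp
    moreover obtain n where "real n * (e (Suc m) - e m) > B - e m"
      using reals_Archimedean3[OF pos] by blast
    ultimately show False using bd[of "m + n"] by (smt (verit))
  qed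
  then have "antimono e" by (rule antimonoI[OF lift_Suc_antimono_le]) auto
  then show ?thesis by (auto dest: antimonoD)
qed

text \<open>Neither translation invariance nor an attained maximum is assumed, so a supremum over
  all pairs at a fixed distance replaces a maximum principle.\<close>

lemma bounded_harmonic_vanishing_on_diagonal:
  fixes d :: "int \<Rightarrow> int \<Rightarrow> real"
  assumes nonneg: "\<And>i j. 0 \<le> d i j" and bd: "\<And>i j. d i j \<le> B"
    and diag: "\<And>i. d i i = 0" and sym: "\<And>i j. d i j = d j i"
    and harm: "\<And>i j. i \<noteq> j \<Longrightarrow>
      4 * d i j = d (i - 1) (j - 1) + d (i - 1) j + d i (j - 1) + d i j"
  shows "d i j = 0"
proof -
  define e where "e m = (SUP i. d i (i + int m))" for m
  have bdd: "bdd_above (range (\<lambda>i. d i (i + int m)))" for m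
    using bd by (auto intro!: bdd_aboveI)
  have le_e: "d i (i + int m) \<le> e m" for i m
    unfolding e_def by (rule cSUP_upper[OF UNIV_I bdd])
  have e_le: "e m \<le> b" if "\<And>i. d i (i + int m) \<le> b" for m b
    unfolding e_def using that by (intro cSUP_least) auto
  have "2 * e (Suc m) \<le> e m + e (Suc (Suc m))" for m
  proof -
    \<comment> \<open>Of the four pairs in \<open>harm\<close>, one is at distance \<open>m\<close>,
      one at \<open>m + 2\<close>, and two at \<open>m + 1\<close>. The distance
      \<open>m + 1\<close> is positive, so the pair is off the diagonal.\<close>
    have "4 * d i (i + int (Suc m)) \<le> e m + e (Suc (Suc m)) + 2 * e (Suc m)" for i
      using harm[of i "i + int (Suc m)"] le_e[of "i - 1" "Suc m"] le_e[of "i - 1" "Suc (Suc m)"]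
        le_e[of i m] le_e[of i "Suc m"]
      by (simp add: algebra_simps)
    then have "e (Suc m) \<le> (e m + e (Suc (Suc m)) + 2 * e (Suc m)) / 4"
      by (intro e_le) (simp add: field_simps)
    then show ?thesis by simp
  qed
  then have "e m \<le> e 0" for m
    by (rule convex_bounded_seq_le) (rule e_le[OF bd])
  moreover have "e 0 = 0" by (simp add: e_def diag)
  ultimately have "d i (i + int m) = 0" for i m
    using nonneg[of i "i + int m"] le_e[of i m] by (smt (verit))
  from this[of i "nat (j - i)"] this[of j "nat (i - j)"] sym[of i j] show ?thesis
    by (cases "i \<le> j") auto
qed

section \<open>The automaton in spin variables\<close>

definition spin :: "bool \<Rightarrow> real" where
  "spin b = (if b then 1 else -1)"

lemma spin_simps [simp]: "spin True = 1" "spin False = -1" "\<bar>spin b\<bar> = 1" "spin b * spin b = 1"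
  by (auto simp: spin_def)

text \<open>These are the spins of \<open>config10\<close>. Multiplying by them makes both
  alternating configurations constant.\<close>

definition parity_sign :: "int \<Rightarrow> real" where
  "parity_sign i = (if even i then 1 else -1)"

locale automaton_A =
  fixes a :: "bool list \<Rightarrow> bool pmf"
  assumes a00: "pmf (a [False, False]) True = 1 / 2"
    and a01: "pmf (a [False, True]) True = 0"
    and a10: "pmf (a [True, False]) True = 1"
    and a11: "pmf (a [True, True]) True = 1 / 2"
begin

abbreviation F :: "(int \<Rightarrow> bool) measure \<Rightarrow> (int \<Rightarrow> bool) measure" where
  "F \<equiv> pca [-1, 0] a"

text \<open>The mean is linear in the old spins without a constant term, so the one-point and
  two-point functions of an invariant measure satisfy closed linear equations.\<close>

lemma mean_spin:
  "(\<Sum>b\<in>UNIV. spin b * pmf (a (local_word [-1, 0] x k)) b) = (spin (x (k - 1)) - spin (x k)) / 2"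
  by (cases "x (k - 1)"; cases "x k")
     (simp_all add: UNIV_bool local_word_def pmf_False_conv_True a00 a01 a10 a11)

section \<open>The alternating orbit and failure of ergodicity\<close>

lemma pca_dirac:
  "F (dirac config01) = dirac config10" "F (dirac config10) = dirac config01"
  and is_pca_image_dirac_alternating:
  "is_pca_image [-1, 0] a (dirac config01) (dirac config10)"
  "is_pca_image [-1, 0] a (dirac config10) (dirac config01)"
proof -
  \<comment> \<open>Only the words 01 and 10 occur here. On them the rule is deterministic and
    copies the left neighbor, which shifts each configuration onto the other.\<close>
  have "pmf (a (local_word [-1, 0] config01 k)) (config10 k) = 1"
    "pmf (a (local_word [-1, 0] config10 k)) (config01 k) = 1" for k
    by (cases "even k"; simp add: local_word_def config01_def config10_def pmf_False_conv_True a01 a10)+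
  then show "is_pca_image [-1, 0] a (dirac config01) (dirac config10)"
    "is_pca_image [-1, 0] a (dirac config10) (dirac config01)"
    by (simp_all add: is_pca_image_dirac)
  then show "F (dirac config01) = dirac config10" "F (dirac config10) = dirac config01"
    by (simp_all add: pca_eqI dirac_in_prob_measures)
qed

lemma invariant_half_sum: "invariant_measure F (half_sum (dirac config01) (dirac config10))"
  unfolding invariant_measure_def
proof
  show h: "half_sum (dirac config01) (dirac config10) \<in> prob_measures"
    by (intro half_sum_in_prob_measures dirac_in_prob_measures)
  show "F (half_sum (dirac config01) (dirac config10)) = half_sum (dirac config01) (dirac config10)"
    \<comment> \<open>The step exchanges the two point masses, so the image has its summands in
      reverse order.\<close>
    by (rule pca_eqI[OF h], subst (2) half_sum_commute)
       (intro is_pca_image_half_sum dirac_in_prob_measures is_pca_image_dirac_alternating)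
qed

lemma not_ergodic: "\<not> ergodic F"
proof
  assume "ergodic F"
  then obtain \<mu> where "weakly_converges (\<lambda>n. (F ^^ n) (dirac config01)) \<mu>"
    unfolding ergodic_def using dirac_in_prob_measures by blast
  \<comment> \<open>The spin at 0 is a bounded continuous observable separating the two points of
    the orbit: its means alternate between -1 and 1.\<close>
  moreover define g where "g x = spin (x 0)" for x :: "int \<Rightarrow> bool"
  have cont: "continuous_on UNIV g"
    unfolding g_def
    by (rule continuous_on_compose2[OF _ continuous_on_product_coordinates[of 0], of UNIV spin])
       (auto intro: continuous_on_discrete)
  moreover have "bounded (range g)"
    by (auto simp: g_def intro!: boundedI[of _ 1])
  ultimately have lim: "(\<lambda>n. integral\<^sup>L ((F ^^ n) (dirac config01)) g) \<longlonglongrightarrow> integral\<^sup>L \<mu> g"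
    unfolding weakly_converges_def by blast
  have "(F ^^ n) (dirac config01) = (if even n then dirac config01 else dirac config10)" for n
    by (induction n) (auto simp: pca_dirac)
  moreover have "integral\<^sup>L (dirac x) g = spin (x 0)" for x
    unfolding dirac_def
    by (subst integral_return)
       (auto simp: g_def intro!: borel_measurable_continuous_onI cont[unfolded g_def])
  ultimately have "integral\<^sup>L ((F ^^ n) (dirac config01)) g = (if even n then -1 else 1)" for n
    by (simp add: config01_def config10_def)
  with lim have l: "(\<lambda>n. if even n then -1 else 1) \<longlonglongrightarrow> integral\<^sup>L \<mu> g" by simp
  have "(\<lambda>n. -1 :: real) \<longlonglongrightarrow> integral\<^sup>L \<mu> g"
    using LIMSEQ_subseq_LIMSEQ[OF l, of "\<lambda>n. 2 * n"] by (simp add: o_def strict_mono_def)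
  moreover have "(\<lambda>n. 1 :: real) \<longlonglongrightarrow> integral\<^sup>L \<mu> g"
    using LIMSEQ_subseq_LIMSEQ[OF l, of "\<lambda>n. 2 * n + 1"] by (simp add: o_def strict_mono_def)
  ultimately show False by (simp add: LIMSEQ_const_iff)
qed

section \<open>Correlations and uniqueness of the invariant measure\<close>

lemma
  assumes inv: "invariant_measure F \<mu>"
  shows integral_spin: "(\<integral>x. spin (x k) \<partial>\<mu>) = (\<integral>x. (spin (x (k - 1)) - spin (x k)) / 2 \<partial>\<mu>)"
    and integral_spin_spin: "i \<noteq> j \<Longrightarrow> (\<integral>x. spin (x i) * spin (x j) \<partial>\<mu>) =
      (\<integral>x. (spin (x (i - 1)) - spin (x i)) / 2 * ((spin (x (j - 1)) - spin (x j)) / 2) \<partial>\<mu>)"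
proof -
  have \<mu>: "\<mu> \<in> prob_measures" and "F \<mu> = \<mu>" using inv by (auto simp: invariant_measure_def)
  then have im: "is_pca_image [-1, 0] a \<mu> \<mu>" using is_pca_image_pca[OF \<mu>] by metis
  \<comment> \<open>Invariance puts the same measure on both sides. Two sites must be distinct for
    \<open>{i, j}\<close> to give a product of two factors.\<close>
  note * = integral_prod_is_pca_image[OF \<mu> im, of _ "\<lambda>_. spin", unfolded mean_spin]
  show "(\<integral>x. spin (x k) \<partial>\<mu>) = (\<integral>x. (spin (x (k - 1)) - spin (x k)) / 2 \<partial>\<mu>)"
    using *[of "{k}"] by simp
  show "(\<integral>x. spin (x i) * spin (x j) \<partial>\<mu>) =
      (\<integral>x. (spin (x (i - 1)) - spin (x i)) / 2 * ((spin (x (j - 1)) - spin (x j)) / 2) \<partial>\<mu>)"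
    if "i \<noteq> j" using *[of "{i, j}"] that by simp
qed

lemma invariant_unique:
  assumes inv: "invariant_measure F \<mu>"
  shows "\<mu> = half_sum (dirac config01) (dirac config10)"
proof -
  have \<mu>: "\<mu> \<in> prob_measures" using inv by (auto simp: invariant_measure_def)
  interpret prob_space \<mu> by (rule prob_measuresD[OF \<mu>])
  have int1 [simp]: "integrable \<mu> (\<lambda>x. spin (x i))" for i
    by (rule integrable_finite_dep[OF \<mu>, of "{i}"]) auto
  have int2 [simp]: "integrable \<mu> (\<lambda>x. spin (x i) * spin (x j))" for i j
    by (rule integrable_finite_dep[OF \<mu>, of "{i, j}"]) auto
  define c where "c i j = (\<integral>x. spin (x i) * spin (x j) \<partial>\<mu>)" for i j
  have c_abs: "\<bar>c i j\<bar> \<le> 1" for i j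
  proof -
    have "\<bar>c i j\<bar> \<le> (\<integral>x. \<bar>spin (x i) * spin (x j)\<bar> \<partial>\<mu>)"
      unfolding c_def by (rule integral_abs_bound)
    then show ?thesis by (simp add: abs_mult prob_space)
  qed
  have c_rec: "c i j = (c (i - 1) (j - 1) - c (i - 1) j - c i (j - 1) + c i j) / 4" if "i \<noteq> j" for i j
  proof -
    have "c i j = (\<integral>x. (spin (x (i - 1)) * spin (x (j - 1)) - spin (x (i - 1)) * spin (x j)
        - spin (x i) * spin (x (j - 1)) + spin (x i) * spin (x j)) / 4 \<partial>\<mu>)"
      unfolding c_def integral_spin_spin[OF inv that]
      by (intro Bochner_Integration.integral_cong) (auto simp: field_simps)
    then show ?thesis by (simp add: c_def)
  qed
  \<comment> \<open>Moving just one of the two sites flips the parity of \<open>i - j\<close>, so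
    this sign turns the two minus signs of \<open>c_rec\<close> into plus signs. The sign
    alternating in time cancels in a product of two spins.\<close>
  define d where "d i j = 1 - parity_sign (i - j) * c i j" for i j
  have d0: "d i j = 0" for i j
  proof (rule bounded_harmonic_vanishing_on_diagonal)
    show "0 \<le> d i j" "d i j \<le> 2" for i j using c_abs[of i j]
      by (auto simp: d_def parity_sign_def abs_le_iff)
    show "d i i = 0" for i by (simp add: d_def parity_sign_def c_def prob_space)
    show "d i j = d j i" for i j by (simp add: d_def parity_sign_def c_def mult.commute)
    show "4 * d i j = d (i - 1) (j - 1) + d (i - 1) j + d i (j - 1) + d i j" if "i \<noteq> j" for i j
      using c_rec[OF that] by (auto simp: d_def parity_sign_def)
  qed
  have alternating: "AE x in \<mu>. \<forall>j. spin (x j) = parity_sign j * spin (x 0)"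
  proof (subst AE_all_countable, rule allI)
    fix j
    \<comment> \<open>This function is nonnegative and its integral is \<open>d j 0 = 0\<close>, so
      it vanishes almost everywhere.\<close>
    let ?h = "\<lambda>x. 1 - parity_sign j * (spin (x j) * spin (x 0))"
    have "integral\<^sup>L \<mu> ?h = 0" using d0[of j 0] by (simp add: d_def c_def prob_space)
    moreover have "?h x \<ge> 0" for x by (auto simp: spin_def parity_sign_def)
    ultimately have "AE x in \<mu>. ?h x = 0"
      by (subst integral_nonneg_eq_0_iff_AE[symmetric]) auto
    then show "AE x in \<mu>. spin (x j) = parity_sign j * spin (x 0)"
      by eventually_elim (auto simp: spin_def parity_sign_def split: if_splits)
  qed
  from alternating have alt: "AE x in \<mu>. x = (if x 0 then config10 else config01)"
    by eventually_elim
       (auto simp: fun_eq_iff spin_def parity_sign_def config01_def config10_def split: if_splits)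
  \<comment> \<open>On alternating configurations the spin at -1 is opposite to the spin at 0, so by
    \<open>integral_spin\<close> the mean spin at 0 equals its own negative.\<close>
  have "AE x in \<mu>. (spin (x (0 - 1)) - spin (x 0)) / 2 = - spin (x 0)"
    using alternating
  proof eventually_elim
    case (elim x)
    from elim[rule_format, of "0 - 1"] show ?case by (simp add: parity_sign_def)
  qed
  then have "(\<integral>x. spin (x 0) \<partial>\<mu>) = (\<integral>x. - spin (x 0) \<partial>\<mu>)"
    unfolding integral_spin[OF inv, of 0]
    by (intro integral_cong_AE borel_measurable_integrable) simp_all
  then have mean0: "(\<integral>x. spin (x 0) \<partial>\<mu>) = 0" by simp
  show ?thesis
  proof (rule measure_eqI_cylinder[OF \<mu>])
    show "half_sum (dirac config01) (dirac config10) \<in> prob_measures"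
      by (intro half_sum_in_prob_measures dirac_in_prob_measures)
  next
    fix K :: "int set" and y :: "int \<Rightarrow> bool"
    assume K: "finite K"
    let ?C = "cylinder K y"
    have C: "?C \<in> sets \<mu>" using K prob_measuresD(2)[OF \<mu>] by simp
    have "measure \<mu> ?C = (\<integral>x. indicator ?C x \<partial>\<mu>)"
      using C prob_measuresD(3)[OF \<mu>] by simp
    \<comment> \<open>Almost everywhere the indicator is determined by \<open>x 0\<close>. It is
      written as the affine function of the spin at 0 that takes its value at
      \<open>config01\<close> for spin -1 and at \<open>config10\<close> for spin 1. As the mean
      spin is zero, the constant term remains.\<close>
    also have "\<dots> = (\<integral>x. (indicator ?C config01 + indicator ?C config10) / 2
        + spin (x 0) * ((indicator ?C config10 - indicator ?C config01) / 2) \<partial>\<mu>)"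
    proof (rule integral_cong_AE)
      show "AE x in \<mu>. indicator ?C x = (indicator ?C config01 + indicator ?C config10) / 2
          + spin (x 0) * ((indicator ?C config10 - indicator ?C config01) / 2)"
        using alt
      proof eventually_elim
        case (elim x)
        then show ?case by (cases "x 0") (auto simp: field_simps)
      qed
      show "(\<lambda>x. (indicator ?C config01 + indicator ?C config10) / 2
          + spin (x 0) * ((indicator ?C config10 - indicator ?C config01) / 2)) \<in> borel_measurable \<mu>"
        by (rule borel_measurable_integrable) simp
    qed (use C in simp)
    also have "\<dots> = (indicator ?C config01 + indicator ?C config10) / 2"
      by (simp add: prob_space mean0)
    also have "\<dots> = measure (half_sum (dirac config01) (dirac config10)) ?C"
      using K by (simp add: measure_half_sum dirac_in_prob_measures) (simp add: dirac_def measure_return)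
    finally show "measure \<mu> ?C = measure (half_sum (dirac config01) (dirac config10)) ?C" .
  qed
qed

end

theorem theorem3p1:
  fixes a :: "bool list \<Rightarrow> bool pmf"
  assumes "pmf (a [False, False]) True = 1 / 2"
    and "pmf (a [False, True]) True = 0"
    and "pmf (a [True, False]) True = 1"
    and "pmf (a [True, True]) True = 1 / 2"
  shows "{\<mu>. invariant_measure (pca [-1, 0] a) \<mu>} = {half_sum (dirac config01) (dirac config10)}
    \<and> \<not> ergodic (pca [-1, 0] a)"
proof -
  interpret automaton_A a by (rule automaton_A.intro[OF assms])
  show ?thesis
  proof (intro conjI equalityI subsetI not_ergodic)
    show "\<mu> \<in> {half_sum (dirac config01) (dirac config10)}"
      if "\<mu> \<in> {\<mu>. invariant_measure F \<mu>}" for \<mu>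
      using that by (simp only: mem_Collect_eq singleton_iff) (rule invariant_unique)
    show "\<mu> \<in> {\<mu>. invariant_measure F \<mu>}"
      if "\<mu> \<in> {half_sum (dirac config01) (dirac config10)}" for \<mu>
      using that invariant_half_sum by (simp only: mem_Collect_eq singleton_iff)
  qed
qed

end
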